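(* Let $\chi$ be a nonlinear kernel with data $(L,\psi,\alpha,\beta)$ relative to $\Pi=(t_k)_{k\in\mathbb{Z}}$. Let $\varphi$ be a convex $\varphi$-function, and suppose that there is a convex $\varphi$-function $\eta$ such that for every $\lambda\in(0,1)$ there is a constant $C_\lambda\in(0,1)$ with $\varphi(C_\lambda\psi(u))\le\eta(\lambda u)$ for every $u\in\mathbb{R}^+_0$; fix such constants $C_\lambda$. Then, for any $f,g\in L^\eta_\mu(\mathbb{R}^+)$, there exist $\lambda\in(0,1)$ and a constant $0<c\le C_\lambda/M_{0,\Pi}(L)$ such that, for every $w>0$, $$I^\varphi_\mu\big[c\,(K^\chi_wf-K^\chi_wg)\big]\le\frac{\|L\|_{1,\mu}}{\delta\,M_{0,\Pi}(L)}\,I^\eta_\mu\big[\lambda\,(f-g)\big].$$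
   Context: Notation: $\mathbb{R}^+=(0,\infty)$, $\mathbb{R}^+_0=[0,\infty)$; $\mu$ is the logarithmic (Haar) measure $\mu(A)=\int_A \frac{dt}{t}$ on $\mathbb{R}^+$, $L^1_\mu(\mathbb{R}^+)$ is the corresponding Lebesgue space and $\|\cdot\|_{1,\mu}$ its norm. A $\varphi$-function is a function $\varphi:\mathbb{R}^+_0\to\mathbb{R}^+_0$ that is non-decreasing and continuous, with $\varphi(0)=0$, $\varphi(u)>0$ for $u>0$, and $\varphi(u)\to+\infty$ as $u\to+\infty$. The associated modular is $I^\varphi_\mu[f]:=\int_0^{+\infty}\varphi(|f(x)|)\frac{dx}{x}$ for measurable $f:\mathbb{R}^+\to\mathbb{R}$, and the Mellin-Orlicz space is $L^\varphi_\mu(\mathbb{R}^+):=\{f \text{ measurable}: I^\varphi_\mu[\lambda f]<+\infty\text{ for some }\lambda>0\}$. $\Pi=(t_k)_{k\in\mathbb{Z}}$ is a sequence of real numbers with $t_k<t_{k+1}$, $\lim_{k\to\pm\infty}t_k=\pm\infty$, for which there are constants $\Delta,\delta>0$ with $\delta\le\Delta_k:=t_{k+1}-t_k\le\Delta$ for every $k\in\mathbb{Z}$. A nonlinear kernel with data $(L,\psi,\alpha,\beta)$, where $L:\mathbb{R}^+\to\mathbb{R}^+_0$ is measurable, $\psi:\mathbb{R}^+_0\to\mathbb{R}^+_0$ is non-decreasing and continuous with $\psi(0)=0$, and $\alpha,\beta>0$, is a function $\chi:\mathbb{R}^+\times\mathbb{R}\to\mathbb{R}$ such that: (1) $(\chi(e^{-t_k}x^w,u))_k\in\ell^1(\mathbb{Z})$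 for every $x\in\mathbb{R}^+$, $u\in\mathbb{R}$, $w>0$; (2) $\chi(x,0)=0$ for every $x\in\mathbb{R}^+$; (3) $|\chi(x,u)-\chi(x,v)|\le L(x)\,\psi(|u-v|)$ for every $x\in\mathbb{R}^+$, $u,v\in\mathbb{R}$; (4) for every $j\in\mathbb{N}$ ($j\ge1$), $$\mathcal{S}^j_w(x):=\sup_{0\le|u|<1/j}\Big|\sum_{k\in\mathbb{Z}}\chi(e^{-t_k}x^w,u)-u\Big|=\mathcal{O}(w^{-\alpha}),\qquad \mathcal{T}^j_w(x):=\sup_{|u|\ge1/j}\Big|\frac1u\sum_{k\in\mathbb{Z}}\chi(e^{-t_k}x^w,u)-1\Big|=\mathcal{O}(w^{-\alpha})$$ as $w\to+\infty$, uniformly with respect to $x\in\mathbb{R}^+$; (5) $L\in L^1_\mu(\mathbb{R}^+)$ and $L$ is bounded; (6) $M_{\beta,\Pi}(L)<+\infty$, where for $\gamma\ge0$, $M_{\gamma,\Pi}(L):=\sup_{x\in\mathbb{R}^+}\sum_{k\in\mathbb{Z}}L(e^{-t_k}x)\,|\ln x-t_k|^\gamma$ (with $M_{0,\Pi}(L):=\sup_{x}\sum_k L(e^{-t_k}x)$). For $w>0$ and a locally integrable $f:\mathbb{R}^+\to\mathbb{R}$ for which the series converges for every $x$, the nonlinear exponential Kantorovich sampling operator is $$(K^\chi_w f)(x):=\sum_{k\in\mathbb{Z}}\chi\Big(e^{-t_k}x^w,\ \frac{w}{\Delta_k}\int_{t_k/w}^{t_{k+1}/w}f(e^u)\,du\Big),\qquad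 x\in\mathbb{R}^+.$$ *)

theory Defs
  imports "HOL-Analysis.Analysis"
begin

definition haar :: "real measure" where
  "haar = density (lebesgue_on {0<..}) (\<lambda>t. ennreal (1 / t))"

text \<open>Functions with domain or codomain $(0,\infty)$ or $[0,\infty)$ are total functions
  on the reals; every condition only constrains them on the intended domain.\<close>

definition phi_function :: "(real \<Rightarrow> real) \<Rightarrow> bool" where
  "phi_function \<phi> \<longleftrightarrow>
     mono_on {0..} \<phi> \<and> continuous_on {0..} \<phi> \<and> \<phi> 0 = 0 \<and> (\<forall>u>0. \<phi> u > 0) \<and>
     filterlim \<phi> at_top at_top"

definition modular :: "(real \<Rightarrow> real) \<Rightarrow> (real \<Rightarrow> real) \<Rightarrow> ennreal" where
  "modular \<phi> f = (\<integral>\<^sup>+x. ennreal (\<phi> \<bar>f x\<bar>) \<partial>haar)"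

definition mellin_orlicz :: "(real \<Rightarrow> real) \<Rightarrow> (real \<Rightarrow> real) set" where
  "mellin_orlicz \<phi> =
     {f \<in> borel_measurable haar. \<exists>\<nu>>0. modular \<phi> (\<lambda>x. \<nu> * f x) < \<infinity>}"

definition sampling_sequence :: "(int \<Rightarrow> real) \<Rightarrow> real \<Rightarrow> real \<Rightarrow> bool" where
  "sampling_sequence t \<delta> \<Delta> \<longleftrightarrow>
     0 < \<delta> \<and> 0 < \<Delta> \<and> (\<forall>k. t k < t (k + 1)) \<and>
     filterlim t at_top at_top \<and> filterlim t at_bot at_bot \<and>
     (\<forall>k. \<delta> \<le> t (k + 1) - t k \<and> t (k + 1) - t k \<le> \<Delta>)"

text \<open>The case distinction is needed because \<open>0 powr 0 = 0\<close>, whereas the moment of order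
  zero is the supremum of the plain sums of the values of \<open>L\<close>.\<close>

definition moment :: "(int \<Rightarrow> real) \<Rightarrow> real \<Rightarrow> (real \<Rightarrow> real) \<Rightarrow> ennreal" where
  "moment t \<gamma> L =
     (SUP x\<in>{0<..}. \<Sum>\<^sub>\<infinity>k.
        ennreal (L (exp (- t k) * x) * (if \<gamma> = 0 then 1 else \<bar>ln x - t k\<bar> powr \<gamma>)))"

definition err_small ::
  "(int \<Rightarrow> real) \<Rightarrow> (real \<Rightarrow> real \<Rightarrow> real) \<Rightarrow> nat \<Rightarrow> real \<Rightarrow> real \<Rightarrow> ennreal" where
  "err_small t X j w x =
     (SUP u\<in>{u. \<bar>u\<bar> < 1 / real j}.
        ennreal \<bar>(\<Sum>\<^sub>\<infinity>k. X (exp (- t k) * x powr w) u) - u\<bar>)"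

definition err_large ::
  "(int \<Rightarrow> real) \<Rightarrow> (real \<Rightarrow> real \<Rightarrow> real) \<Rightarrow> nat \<Rightarrow> real \<Rightarrow> real \<Rightarrow> ennreal" where
  "err_large t X j w x =
     (SUP u\<in>{u. \<bar>u\<bar> \<ge> 1 / real j}.
        ennreal \<bar>1 / u * (\<Sum>\<^sub>\<infinity>k. X (exp (- t k) * x powr w) u) - 1\<bar>)"

definition uniform_bigo_powr :: "real \<Rightarrow> (real \<Rightarrow> real \<Rightarrow> ennreal) \<Rightarrow> bool" where
  "uniform_bigo_powr \<alpha> S \<longleftrightarrow>
     (\<exists>K::real. \<forall>\<^sub>F w in at_top. \<forall>x>0. S w x \<le> ennreal (K * w powr (- \<alpha>)))"

definition nonlinear_kernel ::
  "(int \<Rightarrow> real) \<Rightarrow> (real \<Rightarrow> real) \<Rightarrow> (real \<Rightarrow> real) \<Rightarrow> real \<Rightarrow> real \<Rightarrow>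
     (real \<Rightarrow> real \<Rightarrow> real) \<Rightarrow> bool" where
  "nonlinear_kernel t L \<psi> \<alpha> \<beta> X \<longleftrightarrow>
     L \<in> borel_measurable haar \<and> (\<forall>x>0. 0 \<le> L x) \<and>
     (\<forall>u\<ge>0. 0 \<le> \<psi> u) \<and> mono_on {0..} \<psi> \<and> continuous_on {0..} \<psi> \<and> \<psi> 0 = 0 \<and>
     0 < \<alpha> \<and> 0 < \<beta> \<and>
     (\<forall>x>0. \<forall>u. \<forall>w>0. (\<lambda>k. \<bar>X (exp (- t k) * x powr w) u\<bar>) summable_on UNIV) \<and>
     (\<forall>x>0. X x 0 = 0) \<and>
     (\<forall>x>0. \<forall>u v. \<bar>X x u - X x v\<bar> \<le> L x * \<psi> \<bar>u - v\<bar>) \<and>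
     (\<forall>j\<ge>1. uniform_bigo_powr \<alpha> (err_small t X j) \<and>
            uniform_bigo_powr \<alpha> (err_large t X j)) \<and>
     integrable haar L \<and> bounded (L ` {0<..}) \<and>
     moment t \<beta> L < \<infinity>"

text \<open>Both the series and the integral means are absolutely convergent for
  \<open>f\<close> in the Orlicz spaces considered, so the default values of \<open>infsum\<close> and of the
  Lebesgue integral play no role there.\<close>

definition kantorovich ::
  "(int \<Rightarrow> real) \<Rightarrow> (real \<Rightarrow> real \<Rightarrow> real) \<Rightarrow> real \<Rightarrow> (real \<Rightarrow> real) \<Rightarrow> real \<Rightarrow> real" where
  "kantorovich t X w f x =
     (\<Sum>\<^sub>\<infinity>k. X (exp (- t k) * x powr w)
        (w / (t (k + 1) - t k) * (LINT u:{t k / w..t (k + 1) / w}|lebesgue. f (exp u))))"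

end

theory Submission
  imports Defs
begin

text \<open>
  With \<open>c = C\<^sub>\<nu> / M\<^sub>0\<close> (any \<open>\<nu>\<close> works) the Lipschitz condition and Jensen's inequality for
  the weights \<open>L (exp (- t k) * x powr w) / M\<^sub>0\<close>, whose sum is at most 1, bound
  \<open>\<phi> (c \<bar>K f - K g\<bar>)\<close> by a weighted sum of \<open>\<eta>\<close> at \<open>\<nu>\<close> times the differences of the integral
  means.  Jensen's inequality for the means, Tonelli, and the invariance of the Haar measure, which
  gives \<open>\<integral> L (exp (- t k) * x powr w) dx / x = \<parallel>L\<parallel> / w\<close>, finish the estimate.  The Lebesgue
  measurability questions are settled by identifying the Haar measure with the image of the Lebesgue
  measure under \<open>exp\<close>.  The degenerate case \<open>M\<^sub>0 = 0\<close> forces the kernel to vanish.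
\<close>

section \<open>The Haar measure as the image of Lebesgue measure under \<open>exp\<close>\<close>

lemma space_haar [simp]: "space haar = {0<..}"
  by (simp add: haar_def)

lemma measurable_haar_iff: "F \<in> borel_measurable haar \<longleftrightarrow> F \<in> borel_measurable (lebesgue_on {0<..})"
  by (simp add: haar_def)

lemma measurable_exp_haar: "exp \<in> lebesgue \<rightarrow>\<^sub>M haar"
proof (rule measurableI)
  fix A :: "real set" assume "A \<in> sets haar"
  then have A: "A \<in> sets lebesgue" "A \<subseteq> {0<..}"
    by (auto simp: haar_def sets_restrict_space_iff)
  have "ln differentiable_on A"
    unfolding differentiable_on_def
  proof
    fix x assume "x \<in> A"
    then have "(ln has_real_derivative inverse x) (at x)"
      using A(2) by (intro DERIV_ln) auto
    then show "ln differentiable at x within A"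
      unfolding real_differentiable_def by (blast intro: has_field_derivative_at_within)
  qed
  then have "ln ` A \<in> sets lebesgue"
    by (intro differentiable_image_in_sets_lebesgue A) auto
  moreover have "exp -` A \<inter> space lebesgue = ln ` A"
    using A(2) by (force simp: image_iff)
  ultimately show "exp -` A \<inter> space lebesgue \<in> sets lebesgue"
    by simp
qed auto

text \<open>Substituting \<open>x = exp u\<close>, the derivative cancels the density
  \<open>1 / x\<close>. The substitution is made on compact intervals exhausting the half-line,
  followed by monotone convergence on both sides.\<close>

lemma nn_integral_exp_borel:
  fixes F :: "real \<Rightarrow> ennreal"
  assumes F [measurable]: "F \<in> borel_measurable borel"
  shows "(\<integral>\<^sup>+x. F x * ennreal (1 / x) * indicator {0<..} x \<partial>lborel) = (\<integral>\<^sup>+u. F (exp u) \<partial>lborel)"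
proof -
  \<comment> \<open>The image under \<open>exp\<close> of the interval from \<open>- Suc n\<close>
    to \<open>Suc n\<close>; \<open>Suc\<close> keeps the interval nondegenerate at
    \<open>n = 0\<close>, as the substitution rule demands.\<close>
  let ?I = "\<lambda>n. {exp (- real (Suc n))..exp (real (Suc n))}"
  have subset: "x \<in> ?I n" if "x \<in> ?I m" "m \<le> n" for x m n
  proof -
    have "exp (- real (Suc n)) \<le> exp (- real (Suc m))" "exp (real (Suc m)) \<le> exp (real (Suc n))"
      using that(2) by simp_all
    then show ?thesis
      using that(1) unfolding atLeastAtMost_iff by linarith
  qed
  have ind: "indicator {0<..} x = (SUP n. indicator (?I n) x :: ennreal)" for x
  proof (cases "0 < x")
    case True
    obtain n where "\<bar>ln x\<bar> < real n"
      using reals_Archimedean2 by blast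
    then have "- real (Suc n) \<le> ln x" "ln x \<le> real (Suc n)"
      by simp_all
    then have "exp (- real (Suc n)) \<le> exp (ln x)" "exp (ln x) \<le> exp (real (Suc n))"
      by (simp_all only: exp_le_cancel_iff)
    then have "x \<in> ?I n"
      using True by simp
    then have "(1::ennreal) \<le> (SUP n. indicator (?I n) x)"
      by (intro SUP_upper2[of n]) auto
    moreover have "(SUP n. indicator (?I n) x) \<le> (1::ennreal)"
      by (intro SUP_least) (auto split: split_indicator)
    ultimately have "(SUP n. indicator (?I n) x) = (1::ennreal)"
      by (intro antisym)
    then show ?thesis
      using True by simp
  next
    case False
    then have "x \<notin> ?I n" for n
      using exp_gt_zero[of "- real (Suc n)"] unfolding atLeastAtMost_iff by linarith
    then show ?thesis
      using False by simp
  qed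
  have ind': "1 = (SUP n. indicator {- real (Suc n)..real (Suc n)} x :: ennreal)" for x :: real
  proof (rule antisym)
    obtain n where "\<bar>x\<bar> < real n"
      using reals_Archimedean2 by blast
    then have "x \<in> {- real (Suc n)..real (Suc n)}"
      by auto
    then show "(1::ennreal) \<le> (SUP n. indicator {- real (Suc n)..real (Suc n)} x)"
      by (intro SUP_upper2[of n]) auto
    show "(SUP n. indicator {- real (Suc n)..real (Suc n)} x) \<le> (1::ennreal)"
      by (intro SUP_least) (simp split: split_indicator)
  qed
  have "(\<integral>\<^sup>+x. F x * ennreal (1 / x) * indicator {0<..} x \<partial>lborel)
      = (\<integral>\<^sup>+x. (SUP n. F x * ennreal (1 / x) * indicator (?I n) x) \<partial>lborel)"
    by (subst ind, subst SUP_mult_left_ennreal) (rule refl)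
  also have "\<dots> = (SUP n. \<integral>\<^sup>+x. F x * ennreal (1 / x) * indicator (?I n) x \<partial>lborel)"
  proof (rule nn_integral_monotone_convergence_SUP)
    show "incseq (\<lambda>n x. F x * ennreal (1 / x) * indicator (?I n) x)"
      unfolding incseq_def le_fun_def
      by (intro allI impI mult_left_mono indicator_leI) (erule subset, assumption, rule zero_le)
  qed measurable
  also have "\<dots> = (SUP n. \<integral>\<^sup>+u. F (exp u) * indicator {- real (Suc n)..real (Suc n)} u \<partial>lborel)"
  proof (intro SUP_cong refl)
    fix n
    have "(\<integral>\<^sup>+x. F x * ennreal (1 / x) * indicator (?I n) x \<partial>lborel)
        = (\<integral>\<^sup>+u. F (exp u) * ennreal (1 / exp u) * ennreal (exp u)
             * indicator {- real (Suc n)..real (Suc n)} u \<partial>lborel)"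
      by (rule nn_integral_substitution_aux)
         (auto intro!: derivative_eq_intros continuous_intros)
    also have "\<dots> = (\<integral>\<^sup>+u. F (exp u) * indicator {- real (Suc n)..real (Suc n)} u \<partial>lborel)"
      by (simp add: mult.assoc flip: ennreal_mult)
    finally show "(\<integral>\<^sup>+x. F x * ennreal (1 / x) * indicator (?I n) x \<partial>lborel)
      = (\<integral>\<^sup>+u. F (exp u) * indicator {- real (Suc n)..real (Suc n)} u \<partial>lborel)" .
  qed
  also have "\<dots> = (\<integral>\<^sup>+u. (SUP n. F (exp u) * indicator {- real (Suc n)..real (Suc n)} u) \<partial>lborel)"
    by (rule nn_integral_monotone_convergence_SUP[symmetric])
       (auto simp: incseq_def le_fun_def intro!: mult_left_mono split: split_indicator)
  also have "\<dots> = (\<integral>\<^sup>+u. F (exp u) \<partial>lborel)"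
    by (subst SUP_mult_left_ennreal[symmetric], subst ind'[symmetric]) simp
  finally show ?thesis .
qed

text \<open>Extends the Borel case: a Lebesgue measurable integrand equals a Borel one outside a
  null set, and the pullback of that null set under \<open>exp\<close> is null again.\<close>

lemma nn_integral_haar:
  fixes F :: "real \<Rightarrow> ennreal"
  assumes F: "F \<in> borel_measurable haar"
  shows "(\<integral>\<^sup>+x. F x \<partial>haar) = (\<integral>\<^sup>+u. F (exp u) \<partial>lebesgue)"
proof -
  define G where "G x = F x * indicator {0<..} x" for x
  have G: "G \<in> borel_measurable lebesgue"
    using F unfolding measurable_haar_iff G_def
    by (subst (asm) borel_measurable_restrict_space_iff_ennreal) auto
  then obtain G' where G' [measurable]: "G' \<in> borel_measurable borel"
    and eq: "AE x in lborel. G x = G' x"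
    using completion_ex_borel_measurable[of G lborel] by auto
  obtain N where "{x \<in> space lborel. \<not> G x = G' x} \<subseteq> N" and N0: "emeasure lborel N = 0"
    and "N \<in> sets lborel"
    by (rule AE_E[OF eq])
  then have sub: "{x. G x \<noteq> G' x} \<subseteq> N" and N [measurable]: "N \<in> sets borel"
    by simp_all
  \<comment> \<open>The Borel case applied to the indicator of \<open>N\<close> shows that the
    preimage of \<open>N\<close> under \<open>exp\<close> is null.\<close>
  have "(\<integral>\<^sup>+u. indicator N (exp u) \<partial>lborel) = 0"
  proof -
    have "AE x in lborel. x \<notin> N"
      using N N0 by (intro AE_not_in) (auto simp: null_sets_def)
    then have "(\<integral>\<^sup>+x. indicator N x * ennreal (1 / x) * indicator {0<..} x \<partial>lborel) = 0"
      by (subst nn_integral_0_iff_AE) (auto elim!: eventually_mono)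
    then show ?thesis
      by (simp add: nn_integral_exp_borel)
  qed
  then have "AE u in lborel. indicator N (exp u) = (0::ennreal)"
    by (subst (asm) nn_integral_0_iff_AE) auto
  then have eq': "AE u in lborel. G (exp u) = G' (exp u)"
    by eventually_elim (use sub in \<open>auto simp: indicator_def split: if_splits\<close>)
  have "(\<integral>\<^sup>+x. F x \<partial>haar) = (\<integral>\<^sup>+x\<in>{0<..}. ennreal (1 / x) * F x \<partial>lebesgue)"
    using F unfolding measurable_haar_iff unfolding haar_def
    by (subst nn_integral_density) (auto simp: nn_integral_restrict_space intro!: measurable_restrict_space1 measurable_completion)
  also have "\<dots> = (\<integral>\<^sup>+x. G x * ennreal (1 / x) * indicator {0<..} x \<partial>lborel)"
    by (subst nn_integral_completion) (auto simp: G_def ac_simps intro!: nn_integral_cong split: split_indicator)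
  also have "\<dots> = (\<integral>\<^sup>+x. G' x * ennreal (1 / x) * indicator {0<..} x \<partial>lborel)"
    using eq by (intro nn_integral_cong_AE) auto
  also have "\<dots> = (\<integral>\<^sup>+u. G (exp u) \<partial>lborel)"
    using eq' by (subst nn_integral_exp_borel) (auto intro!: nn_integral_cong_AE)
  also have "\<dots> = (\<integral>\<^sup>+u. F (exp u) \<partial>lebesgue)"
    by (simp add: nn_integral_completion G_def)
  finally show ?thesis .
qed

section \<open>Series as integrals, and convexity\<close>

text \<open>Gives series access to Tonelli and to Jensen's inequality for measures. Both sides are
  suprema of finite sums; countability supplies the increasing finite sets \<open>A n\<close> needed
  for monotone convergence.\<close>

lemma nn_integral_count_space_eq_infsum:
  fixes a :: "'a::countable \<Rightarrow> ennreal"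
  shows "(\<integral>\<^sup>+k. a k \<partial>count_space UNIV) = (\<Sum>\<^sub>\<infinity>k. a k)"
proof -
  have inf: "(\<Sum>\<^sub>\<infinity>k. a k) = (SUP F\<in>{F. finite F \<and> F \<subseteq> UNIV}. sum a F)"
    by (rule nonneg_infsum_complete) auto
  have fin: "(\<integral>\<^sup>+k. a k * indicator F k \<partial>count_space UNIV) = sum a F" if "finite F" for F
    using that by (subst nn_integral_count_space'[of F]) auto
  define A :: "nat \<Rightarrow> 'a set" where "A n = {k. to_nat k < n}" for n
  have finA: "finite (A n)" for n
    using finite_vimageI[of "{..<n}" "to_nat :: 'a \<Rightarrow> nat"] by (simp add: A_def vimage_def)
  have "(\<integral>\<^sup>+k. a k \<partial>count_space UNIV) = (\<integral>\<^sup>+k. (SUP n. a k * indicator (A n) k) \<partial>count_space UNIV)"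
  proof (intro nn_integral_cong antisym SUP_least)
    fix k show "a k \<le> (SUP n. a k * indicator (A n) k)"
      by (intro SUP_upper2[of "Suc (to_nat k)"]) (auto simp: A_def)
  qed (auto split: split_indicator)
  also have "\<dots> = (SUP n. \<integral>\<^sup>+k. a k * indicator (A n) k \<partial>count_space UNIV)"
    by (rule nn_integral_monotone_convergence_SUP)
       (auto simp: incseq_def le_fun_def A_def intro!: mult_left_mono split: split_indicator)
  also have "\<dots> \<le> (\<Sum>\<^sub>\<infinity>k. a k)"
    unfolding inf using finA by (auto simp: fin intro!: SUP_least SUP_upper)
  finally have le: "(\<integral>\<^sup>+k. a k \<partial>count_space UNIV) \<le> (\<Sum>\<^sub>\<infinity>k. a k)" .
  moreover have "(\<Sum>\<^sub>\<infinity>k. a k) \<le> (\<integral>\<^sup>+k. a k \<partial>count_space UNIV)"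
    unfolding inf
    by (auto intro!: SUP_least nn_integral_mono simp flip: fin split: split_indicator)
  ultimately show ?thesis
    by (rule antisym)
qed

text \<open>Total mass below 1 is allowed because \<open>q 0 = 0\<close>: the supporting line of \<open>q\<close> at the
  integral is nonpositive at 0.\<close>

lemma jensen_subprobability:
  fixes q :: "real \<Rightarrow> real"
  assumes q: "convex_on UNIV q" "q 0 = 0" "\<And>y. 0 \<le> q y"
    and M: "emeasure M (space M) \<le> 1" and p: "integrable M p"
  shows "ennreal (q (LINT x|M. p x)) \<le> (\<integral>\<^sup>+x. ennreal (q (p x)) \<partial>M)"
proof -
  interpret finite_measure M
    using M by (intro finite_measureI) (auto simp: top_unique)
  define A where "A = measure M (space M)"
  have A: "0 \<le> A" "A \<le> 1"
    using M by (auto simp: A_def emeasure_eq_measure)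
  define e where "e = (LINT x|M. p x)"
  obtain m where m: "\<And>y. q e + m * (y - e) \<le> q y"
    using convex_le_Inf_differential[OF q(1), of e] by auto
  have "continuous_on UNIV q"
    by (rule convex_on_continuous) (use q in auto)
  then have [measurable]: "q \<in> borel_measurable borel"
    by (rule borel_measurable_continuous_onI)
  have [measurable]: "p \<in> borel_measurable M"
    using p by auto
  show ?thesis
  proof (cases "integrable M (\<lambda>x. q (p x))")
    case True
    \<comment> \<open>The intercept of the supporting line is nonpositive, so scaling it by the
      total mass \<open>A \<le> 1\<close> can only increase it.\<close>
    have "(q e - m * e) * (1 - A) \<le> 0"
      using m[of 0] q(2) A by (intro mult_nonpos_nonneg) auto
    then have "q e \<le> (q e - m * e) * A + m * e"
      by (simp add: algebra_simps)
    also have "\<dots> = (LINT x|M. (q e - m * e) + m * p x)"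
      using p by (simp add: A_def e_def)
    also have "\<dots> \<le> (LINT x|M. q (p x))"
    proof (intro integral_mono)
      fix x show "q e - m * e + m * p x \<le> q (p x)"
        using m[of "p x"] by (simp add: algebra_simps)
    qed (use p True in auto)
    finally show ?thesis
      using True q(3) by (subst nn_integral_eq_integral) (auto simp: e_def)
  next
    case False
    then have "(\<integral>\<^sup>+x. ennreal (q (p x)) \<partial>M) = \<infinity>"
      using q(3) by (auto simp: integrable_iff_bounded not_less top_unique)
    then show ?thesis
      by simp
  qed
qed

text \<open>The integral means may have either sign, so Jensen's inequality is applied to the even
  extension. Monotonicity lets the triangle inequality pass through \<open>q\<close>.\<close>

lemma convex_on_abs:
  fixes q :: "real \<Rightarrow> real"
  assumes q: "convex_on {0..} q" and mono: "mono_on {0..} q"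
  shows "convex_on UNIV (\<lambda>u. q \<bar>u\<bar>)"
proof (rule convex_onI)
  fix s x y :: real assume s: "0 < s" "s < 1"
  have "\<bar>(1 - s) *\<^sub>R x + s *\<^sub>R y\<bar> \<le> (1 - s) *\<^sub>R \<bar>x\<bar> + s *\<^sub>R \<bar>y\<bar>"
    using s by (auto intro!: order_trans[OF abs_triangle_ineq] simp: abs_mult)
  then have "q \<bar>(1 - s) *\<^sub>R x + s *\<^sub>R y\<bar> \<le> q ((1 - s) *\<^sub>R \<bar>x\<bar> + s *\<^sub>R \<bar>y\<bar>)"
    using s by (intro mono_onD[OF mono]) auto
  also have "\<dots> \<le> (1 - s) * q \<bar>x\<bar> + s * q \<bar>y\<bar>"
    using s by (intro convex_onD[OF q]) auto
  finally show "q \<bar>(1 - s) *\<^sub>R x + s *\<^sub>R y\<bar> \<le> (1 - s) * q \<bar>x\<bar> + s * q \<bar>y\<bar>" .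
qed auto

section \<open>Invariance of the Haar measure under the kernel arguments\<close>

lemma measurable_ln_haar: "ln \<in> haar \<rightarrow>\<^sub>M lebesgue"
proof (rule measurableI)
  fix A :: "real set" assume A: "A \<in> sets lebesgue"
  have "exp differentiable_on A"
    unfolding differentiable_on_def real_differentiable_def
    by (blast intro: has_field_derivative_at_within DERIV_exp)
  then have "exp ` A \<in> sets lebesgue"
    by (intro differentiable_image_in_sets_lebesgue A) auto
  moreover have "ln -` A \<inter> space haar = exp ` A"
    by (force simp: image_iff)
  ultimately show "ln -` A \<inter> space haar \<in> sets haar"
    by (auto simp: haar_def sets_restrict_space_iff)
qed simp

lemma measurable_affine_lebesgue:
  fixes c s :: real
  assumes "c \<noteq> 0"
  shows "(\<lambda>u. s + c * u) \<in> lebesgue \<rightarrow>\<^sub>M lebesgue"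
  using lebesgue_affine_measurable[of "\<lambda>_::real. c" s] assms by simp

lemma exp_affine_eq: "0 < x \<Longrightarrow> exp (- s) * x powr w = exp (- s + w * ln x)" for x :: real
  by (simp add: powr_def flip: exp_add)

text \<open>In the coordinate \<open>ln x\<close> the map is affine, so it factors as
  \<open>ln\<close>, an affine map and \<open>exp\<close>, each measurable for the completed
  measures.\<close>

lemma measurable_kernel_argument:
  assumes "0 < w"
  shows "(\<lambda>x. exp (- s) * x powr w) \<in> haar \<rightarrow>\<^sub>M haar"
proof -
  have "(\<lambda>x. exp (- s + w * ln x)) \<in> haar \<rightarrow>\<^sub>M haar"
    using assms
    by (intro measurable_compose[OF measurable_compose[OF measurable_ln_haar measurable_affine_lebesgue]
          measurable_exp_haar]) auto
  then show ?thesis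
    by (rule measurable_cong[THEN iffD1, rotated]) (simp add: exp_affine_eq)
qed

text \<open>In the coordinate \<open>ln x\<close> the argument becomes \<open>- s + w * u\<close>:
  Lebesgue measure ignores the translation, and the dilation contributes
  \<open>1 / w\<close>.\<close>

lemma nn_integral_kernel_argument:
  fixes F :: "real \<Rightarrow> ennreal"
  assumes F: "F \<in> borel_measurable haar" and w: "0 < w"
  shows "(\<integral>\<^sup>+x. F (exp (- s) * x powr w) \<partial>haar) = ennreal (1 / w) * (\<integral>\<^sup>+x. F x \<partial>haar)"
proof -
  have "(\<integral>\<^sup>+x. F x \<partial>haar) = ennreal \<bar>w\<bar> * (\<integral>\<^sup>+u. F (exp (- s + w * u)) \<partial>lebesgue)"
    unfolding nn_integral_haar[OF F]
    using w by (intro nn_integral_real_affine_lebesgue measurable_compose[OF measurable_exp_haar F]) auto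
  also have "(\<integral>\<^sup>+u. F (exp (- s + w * u)) \<partial>lebesgue) = (\<integral>\<^sup>+x. F (exp (- s) * x powr w) \<partial>haar)"
    by (subst nn_integral_haar)
       (auto intro: measurable_compose[OF measurable_kernel_argument[OF w] F] simp: exp_affine_eq)
  finally show ?thesis
    using w by (simp add: mult.assoc[symmetric] ennreal_mult[symmetric])
qed

section \<open>Sampling sequences and the moment of order zero\<close>

lemma sampling_sequence_gap:
  assumes "sampling_sequence t \<delta> \<Delta>" "i \<le> j"
  shows "real_of_int (j - i) * \<delta> \<le> t j - t i"
  using assms(2)
proof (induction j rule: int_ge_induct)
  case (step j)
  have "\<delta> \<le> t (j + 1) - t j"
    using assms(1) by (auto simp: sampling_sequence_def)
  with step show ?case
    by (simp add: algebra_simps)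
qed simp

text \<open>Disjointness of the half-open cells, used when integrals over all cells are added up. A
  cell with a larger index starts at or after the right end of the other.\<close>

lemma sampling_sequence_unique:
  assumes t: "sampling_sequence t \<delta> \<Delta>"
    and "t i \<le> s" "s < t (i + 1)" "t j \<le> s" "s < t (j + 1)"
  shows "i = j"
proof -
  have \<delta>: "0 < \<delta>"
    using t by (simp add: sampling_sequence_def)
  have *: "t (i + 1) \<le> t j" if "i < j" for i j
  proof -
    have "0 \<le> real_of_int (j - (i + 1)) * \<delta>"
      using that \<delta> by (intro mult_nonneg_nonneg) auto
    then show ?thesis
      using sampling_sequence_gap[OF t, of "i + 1" j] that by linarith
  qed
  show ?thesis
    using *[of i j] *[of j i] assms by (cases i j rule: linorder_cases) auto
qed

text \<open>The indices are split by the distance from \<open>t k\<close> to \<open>ln x\<close>.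
  Within distance 1 there are boundedly many, each contributing at most \<open>B\<close>; beyond it
  the factor with exponent \<open>\<beta>\<close> is at least 1, so the moment of order
  \<open>\<beta>\<close> dominates.\<close>

lemma moment_0_finite:
  assumes t: "sampling_sequence t \<delta> \<Delta>"
    and L: "\<And>x. 0 < x \<Longrightarrow> 0 \<le> L x" "bounded (L ` {0<..})"
    and \<beta>: "0 < \<beta>" "moment t \<beta> L < \<infinity>"
  shows "moment t 0 L < \<infinity>"
proof -
  obtain B where B: "\<And>x. 0 < x \<Longrightarrow> L x \<le> B"
    using L(2) by (auto simp: bounded_iff abs_le_iff)
  have \<delta>: "0 < \<delta>"
    using t by (simp add: sampling_sequence_def)
  \<comment> \<open>\<open>N\<close> gaps span at least 2, the length of the window around
    \<open>ln x\<close>, so indices in \<open>S\<close> differ by at most \<open>N\<close>.\<close>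
  define N where "N = \<lceil>2 / \<delta>\<rceil>"
  have N: "2 \<le> real_of_int N * \<delta>"
    using \<delta> le_of_int_ceiling[of "2 / \<delta>"] unfolding N_def by (subst (asm) pos_divide_le_eq)
  have "(\<Sum>\<^sub>\<infinity>k. ennreal (L (exp (- t k) * x))) \<le> ennreal B * of_nat (card {- N..N}) + moment t \<beta> L"
    if x: "0 < x" for x
  proof -
    define S where "S = {k. \<bar>ln x - t k\<bar> \<le> 1}"
    have S: "finite S \<and> card S \<le> card {- N..N}"
    proof (cases "S = {}")
      case False
      then obtain i where i: "i \<in> S"
        by auto
      have near: "j - i \<le> N" if "i \<in> S" "j \<in> S" for i j
      proof (rule ccontr)
        assume "\<not> j - i \<le> N"
        moreover have "0 \<le> N"
          using \<delta> less_trans[of "-1" 0 "2 / \<delta>"] by (simp add: N_def)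
        ultimately have "i \<le> j" "real_of_int N * \<delta> < real_of_int (j - i) * \<delta>"
          using \<delta> by (auto intro: mult_strict_right_mono)
        with sampling_sequence_gap[OF t, of i j] N have "2 < t j - t i"
          by linarith
        with that show False
          by (auto simp: S_def)
      qed
      \<comment> \<open>Centering at one element \<open>i\<close> of \<open>S\<close> bounds the
        cardinality independently of \<open>x\<close>.\<close>
      have "S \<subseteq> (+) i ` {- N..N}"
      proof
        fix j assume "j \<in> S"
        then have "j - i \<in> {- N..N}"
          using near[of i j] near[of j i] i by auto
        then show "j \<in> (+) i ` {- N..N}"
          by (rule rev_image_eqI) simp
      qed
      moreover have "finite ((+) i ` {- N..N})" "card ((+) i ` {- N..N}) = card {- N..N}"
        by (auto intro: card_image)
      ultimately show ?thesis
        by (metis card_mono finite_subset)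
    qed simp
    have "(\<Sum>\<^sub>\<infinity>k. ennreal (L (exp (- t k) * x))) = (\<integral>\<^sup>+k. ennreal (L (exp (- t k) * x)) \<partial>count_space UNIV)"
      by (simp add: nn_integral_count_space_eq_infsum)
    also have "\<dots> \<le> (\<integral>\<^sup>+k. ennreal B * indicator S k
        + ennreal (L (exp (- t k) * x) * \<bar>ln x - t k\<bar> powr \<beta>) \<partial>count_space UNIV)"
    proof (intro nn_integral_mono)
      fix k
      show "ennreal (L (exp (- t k) * x)) \<le> ennreal B * indicator S k
        + ennreal (L (exp (- t k) * x) * \<bar>ln x - t k\<bar> powr \<beta>)"
      proof (cases "k \<in> S")
        case True
        then show ?thesis
          using B[of "exp (- t k) * x"] x by (auto intro!: add_increasing2 ennreal_leI)
      next
        case False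
        then have "1 \<le> \<bar>ln x - t k\<bar> powr \<beta>"
          using \<beta> by (intro ge_one_powr_ge_zero) (auto simp: S_def)
        then have "L (exp (- t k) * x) * 1 \<le> L (exp (- t k) * x) * \<bar>ln x - t k\<bar> powr \<beta>"
          using L(1)[of "exp (- t k) * x"] x by (intro mult_left_mono) auto
        then show ?thesis
          using False by (auto intro!: ennreal_leI)
      qed
    qed
    also have "\<dots> = ennreal B * of_nat (card S)
        + (\<Sum>\<^sub>\<infinity>k. ennreal (L (exp (- t k) * x) * \<bar>ln x - t k\<bar> powr \<beta>))"
    proof -
      have "(\<integral>\<^sup>+k. ennreal B * indicator S k \<partial>count_space UNIV) = ennreal B * of_nat (card S)"
        using S by (subst nn_integral_cmult_indicator) auto
      then show ?thesis
        by (subst nn_integral_add) (simp_all flip: nn_integral_count_space_eq_infsum)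
    qed
    also have "\<dots> \<le> ennreal B * of_nat (card {- N..N}) + moment t \<beta> L"
      using S x \<beta> unfolding moment_def
      by (intro add_mono mult_left_mono) (auto intro!: SUP_upper2[of x])
    finally show ?thesis .
  qed
  then have "moment t 0 L \<le> ennreal B * of_nat (card {- N..N}) + moment t \<beta> L"
    unfolding moment_def[of t 0] by (intro SUP_least) simp
  also have "\<dots> < \<infinity>"
    using \<beta>(2) by (simp add: ennreal_mult_less_top of_nat_less_top)
  finally show ?thesis .
qed

section \<open>Local integrability in the Orlicz space\<close>

text \<open>Turns a finite modular into integrability. For \<open>y > 1\<close>, the point 1 is the
  convex combination of 0 and \<open>y\<close> with weight \<open>1 / y\<close> on \<open>y\<close>,
  whence \<open>\<eta> 1 \<le> \<eta> y / y\<close>.\<close>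

lemma phi_function_linear_growth:
  assumes "phi_function \<eta>" "convex_on {0..} \<eta>"
  obtains B where "0 \<le> B" "\<And>y. 0 \<le> y \<Longrightarrow> y \<le> 1 + B * \<eta> y"
proof
  have \<eta>: "\<eta> 0 = 0" "0 < \<eta> 1" "mono_on {0..} \<eta>"
    using assms(1) by (auto simp: phi_function_def)
  show "0 \<le> 1 / \<eta> 1"
    using \<eta> by simp
  fix y :: real assume y: "0 \<le> y"
  have "0 \<le> \<eta> y"
    using mono_onD[OF \<eta>(3), of 0 y] y \<eta>(1) by simp
  show "y \<le> 1 + 1 / \<eta> 1 * \<eta> y"
  proof (cases "y \<le> 1")
    case True
    then show ?thesis
      using \<eta> \<open>0 \<le> \<eta> y\<close> by (simp add: add_increasing2)
  next
    case False
    then have "\<eta> ((1 - 1 / y) *\<^sub>R 0 + (1 / y) *\<^sub>R y) \<le> (1 - 1 / y) * \<eta> 0 + 1 / y * \<eta> y"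
      by (intro convex_onD[OF assms(2)]) auto
    then have "y \<le> \<eta> y / \<eta> 1"
      using False \<eta> by (simp add: field_simps)
    then show ?thesis
      by simp
  qed
qed

lemma phi_function_nonneg: "phi_function \<eta> \<Longrightarrow> 0 \<le> y \<Longrightarrow> 0 \<le> \<eta> y"
  unfolding phi_function_def by (metis less_eq_real_def)

lemma phi_function_measurable:
  assumes "phi_function \<eta>"
  shows "(\<lambda>u. \<eta> \<bar>u\<bar>) \<in> borel_measurable borel"
proof -
  have "continuous_on UNIV (\<lambda>u. \<eta> \<bar>u\<bar>)"
    by (rule continuous_on_compose2[of "{0..}" \<eta>])
       (use assms in \<open>auto simp: phi_function_def intro: continuous_on_rabs continuous_on_id\<close>)
  then show ?thesis
    by (rule borel_measurable_continuous_onI)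
qed

lemma mellin_orlicz_exp_measurable:
  "f \<in> mellin_orlicz \<eta> \<Longrightarrow> (\<lambda>u. f (exp u)) \<in> borel_measurable lebesgue"
  unfolding mellin_orlicz_def by (auto intro: measurable_compose[OF measurable_exp_haar])

text \<open>Linear growth bounds \<open>f (exp u)\<close> by a constant plus a multiple of the
  globally integrable \<open>F\<close>. Hence the bound depends on the length of the interval but
  not on its position, which later makes the means bounded uniformly in \<open>k\<close>.\<close>

lemma mellin_orlicz_means:
  assumes \<eta>: "phi_function \<eta>" "convex_on {0..} \<eta>" and f: "f \<in> mellin_orlicz \<eta>"
  shows "\<And>a b. set_integrable lebesgue {a..b} (\<lambda>u. f (exp u))"
    and "\<exists>A B. 0 \<le> A \<and> 0 \<le> B \<and>
      (\<forall>a b. a \<le> b \<longrightarrow> \<bar>LINT u:{a..b}|lebesgue. f (exp u)\<bar> \<le> A * (b - a) + B)"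
proof -
  obtain \<nu> where \<nu>: "0 < \<nu>" "modular \<eta> (\<lambda>x. \<nu> * f x) < \<infinity>" and [measurable]: "f \<in> borel_measurable haar"
    using f by (auto simp: mellin_orlicz_def)
  obtain B where B: "0 \<le> B" "\<And>y. 0 \<le> y \<Longrightarrow> y \<le> 1 + B * \<eta> y"
    using phi_function_linear_growth[OF \<eta>] by blast
  note [measurable] = phi_function_measurable[OF \<eta>(1)] mellin_orlicz_exp_measurable[OF f]
  define F where "F u = \<eta> \<bar>\<nu> * f (exp u)\<bar>" for u
  have F_nonneg: "0 \<le> F u" for u
    by (simp add: F_def phi_function_nonneg[OF \<eta>(1)])
  have F_meas [measurable]: "F \<in> borel_measurable lebesgue"
    unfolding F_def by measurable
  have "(\<integral>\<^sup>+u. ennreal (F u) \<partial>lebesgue) < \<infinity>"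
    using \<nu>(2) unfolding modular_def F_def
    by (subst (asm) nn_integral_haar) (auto simp: \<nu>)
  then have F: "integrable lebesgue F"
    using F_nonneg by (simp add: integrable_iff_bounded F_meas)
  \<comment> \<open>Linear growth at \<open>y = \<bar>\<nu> * f (exp u)\<bar>\<close>, divided by
    \<open>\<nu>\<close>.\<close>
  have bound: "\<bar>f (exp u)\<bar> \<le> 1 / \<nu> + B / \<nu> * F u" for u
    using B(2)[of "\<bar>\<nu> * f (exp u)\<bar>"] \<nu>(1) by (simp add: F_def abs_mult field_simps)
  have int1: "integrable lebesgue (\<lambda>u. indicator {a..b} u * (1 / \<nu>))" for a b :: real
    by (intro integrable_mult_left) (simp add: integrable_indicator_iff emeasure_lborel_Icc_eq)
  have int: "integrable lebesgue (\<lambda>u. indicator {a..b} u * (1 / \<nu>) + B / \<nu> * F u)" for a b :: real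
    using int1 F by (intro Bochner_Integration.integrable_add integrable_mult_right)
  have ind: "\<bar>indicator {a..b} u *\<^sub>R f (exp u)\<bar> \<le> indicator {a..b} u * (1 / \<nu>) + B / \<nu> * F u" for a b u
    using bound[of u] F_nonneg[of u] B(1) \<nu>(1) by (auto split: split_indicator)
  show si: "set_integrable lebesgue {a..b} (\<lambda>u. f (exp u))" for a b
    unfolding set_integrable_def
  proof (rule Bochner_Integration.integrable_bound[OF int[of a b]])
    show "(\<lambda>u. indicator {a..b} u *\<^sub>R f (exp u)) \<in> borel_measurable lebesgue"
      by (intro borel_measurable_scaleR borel_measurable_indicator) auto
  qed (use ind[of a b] in \<open>auto intro!: AE_I2 order_trans[OF _ abs_ge_self]\<close>)
  have "\<bar>LINT u:{a..b}|lebesgue. f (exp u)\<bar> \<le> 1 / \<nu> * (b - a) + B / \<nu> * (LINT u|lebesgue. F u)" if "a \<le> b" for a b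
  proof -
    have "\<bar>LINT u:{a..b}|lebesgue. f (exp u)\<bar> \<le> (LINT u|lebesgue. \<bar>indicator {a..b} u *\<^sub>R f (exp u)\<bar>)"
      unfolding set_lebesgue_integral_def by (rule integral_abs_bound)
    also have "\<dots> \<le> (LINT u|lebesgue. indicator {a..b} u * (1 / \<nu>) + B / \<nu> * F u)"
      using si int ind by (intro integral_mono) (auto simp: set_integrable_def)
    also have "\<dots> = 1 / \<nu> * (b - a) + B / \<nu> * (LINT u|lebesgue. F u)"
      using int1[of a b] F that by (subst Bochner_Integration.integral_add) auto
    finally show ?thesis .
  qed
  moreover have "0 \<le> (LINT u|lebesgue. F u)"
    using F_nonneg by (intro Bochner_Integration.integral_nonneg) auto
  ultimately show "\<exists>A B. 0 \<le> A \<and> 0 \<le> B \<and>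
      (\<forall>a b. a \<le> b \<longrightarrow> \<bar>LINT u:{a..b}|lebesgue. f (exp u)\<bar> \<le> A * (b - a) + B)"
    using \<nu>(1) B(1) by (intro exI[of _ "1 / \<nu>"] exI[of _ "B / \<nu> * (LINT u|lebesgue. F u)"]) auto
qed

section \<open>Jensen's inequality for means and for series\<close>

text \<open>The mean is the integral of \<open>h\<close> against the uniform probability measure on
  the interval, realized as Lebesgue measure with density \<open>r\<close>.\<close>

lemma jensen_mean:
  fixes q h :: "real \<Rightarrow> real"
  assumes q: "convex_on UNIV q" "q 0 = 0" "\<And>y. 0 \<le> q y" and ab: "a < b"
    and h [measurable]: "h \<in> borel_measurable lebesgue" and int: "set_integrable lebesgue {a..b} h"
  shows "ennreal (q (1 / (b - a) * (LINT u:{a..b}|lebesgue. h u)))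
    \<le> ennreal (1 / (b - a)) * (\<integral>\<^sup>+u\<in>{a..b}. ennreal (q (h u)) \<partial>lebesgue)"
proof -
  define r where "r u = 1 / (b - a) * indicator {a..b} u" for u :: real
  have r_nonneg: "0 \<le> r u" for u
    using ab by (simp add: r_def)
  have [measurable]: "r \<in> borel_measurable lebesgue"
    unfolding r_def by (intro borel_measurable_times borel_measurable_const borel_measurable_indicator) auto
  have [measurable]: "q \<in> borel_measurable borel"
    by (intro borel_measurable_continuous_onI convex_on_continuous q) simp
  have int': "integrable lebesgue (\<lambda>u. 1 / (b - a) * (indicator {a..b} u *\<^sub>R h u))"
    using int unfolding set_integrable_def by (rule integrable_mult_right)
  let ?M = "density lebesgue (\<lambda>u. ennreal (r u))"
  have r_eq: "ennreal (r u) = ennreal (1 / (b - a)) * indicator {a..b} u" for u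
    by (simp add: r_def split: split_indicator)
  have "emeasure ?M (space ?M) = (\<integral>\<^sup>+u. ennreal (r u) \<partial>lebesgue)"
    by (subst emeasure_density) auto
  also have "\<dots> = ennreal (1 / (b - a)) * emeasure lebesgue {a..b}"
    unfolding r_eq by (rule nn_integral_cmult_indicator) simp
  also have "\<dots> = 1"
    using ab by (simp flip: ennreal_mult)
  finally have "emeasure ?M (space ?M) \<le> 1"
    by simp
  moreover have "integrable ?M h"
  proof (subst integrable_density)
    show "integrable lebesgue (\<lambda>u. r u *\<^sub>R h u)"
      using int' by (simp add: r_def mult.assoc)
  qed (auto simp: r_nonneg)
  ultimately have "ennreal (q (LINT u|?M. h u)) \<le> (\<integral>\<^sup>+u. ennreal (q (h u)) \<partial>?M)"
    by (intro jensen_subprobability q)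
  also have "(LINT u|?M. h u) = 1 / (b - a) * (LINT u:{a..b}|lebesgue. h u)"
  proof (subst integral_density)
    show "(LINT u|lebesgue. r u *\<^sub>R h u) = 1 / (b - a) * (LINT u:{a..b}|lebesgue. h u)"
      by (simp add: r_def set_lebesgue_integral_def mult.assoc)
  qed (auto simp: r_nonneg)
  also have "(\<integral>\<^sup>+u. ennreal (q (h u)) \<partial>?M) = ennreal (1 / (b - a)) * (\<integral>\<^sup>+u\<in>{a..b}. ennreal (q (h u)) \<partial>lebesgue)"
  proof -
    have "(\<integral>\<^sup>+u. ennreal (q (h u)) \<partial>?M) = (\<integral>\<^sup>+u. ennreal (r u) * ennreal (q (h u)) \<partial>lebesgue)"
      by (rule nn_integral_density) auto
    also have "\<dots> = (\<integral>\<^sup>+u. ennreal (1 / (b - a)) * (ennreal (q (h u)) * indicator {a..b} u) \<partial>lebesgue)"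
      unfolding r_eq by (simp add: ac_simps)
    also have "\<dots> = ennreal (1 / (b - a)) * (\<integral>\<^sup>+u\<in>{a..b}. ennreal (q (h u)) \<partial>lebesgue)"
      by (rule nn_integral_cmult) (intro borel_measurable_times_ennreal borel_measurable_indicator, auto)
    finally show ?thesis .
  qed
  finally show ?thesis .
qed

text \<open>The weights are read as the density of a measure on the index set, whose total mass is
  at most 1.\<close>

lemma jensen_series:
  fixes a p :: "'a \<Rightarrow> real"
  assumes q: "convex_on UNIV q" "q 0 = 0" "\<And>y. 0 \<le> q y"
    and a: "\<And>k. 0 \<le> a k" "(\<integral>\<^sup>+k. ennreal (a k) \<partial>count_space UNIV) \<le> 1"
    and p: "integrable (count_space UNIV) (\<lambda>k. a k * p k)"
  shows "ennreal (q (LINT k|count_space UNIV. a k * p k))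
    \<le> (\<integral>\<^sup>+k. ennreal (a k) * ennreal (q (p k)) \<partial>count_space UNIV)"
proof -
  let ?M = "density (count_space UNIV) (\<lambda>k. ennreal (a k))"
  have "ennreal (q (LINT k|?M. p k)) \<le> (\<integral>\<^sup>+k. ennreal (q (p k)) \<partial>?M)"
    using a p by (intro jensen_subprobability q) (auto simp: emeasure_density integrable_density)
  then show ?thesis
    using a(1) by (simp add: integral_density nn_integral_density)
qed

section \<open>Convergence of the series and sums of kernel values\<close>

lemma integrable_count_space_bounded:
  fixes a p :: "'a \<Rightarrow> real"
  assumes a: "\<And>k. 0 \<le> a k" "(\<integral>\<^sup>+k. ennreal (a k) \<partial>count_space UNIV) < \<infinity>"
    and p: "\<And>k. \<bar>p k\<bar> \<le> a k * D"
  shows "integrable (count_space UNIV) p"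
proof (rule Bochner_Integration.integrable_bound)
  show "integrable (count_space UNIV) (\<lambda>k. a k * D)"
    using a by (intro integrable_mult_left) (simp add: integrable_iff_bounded)
qed (use p in \<open>auto intro!: AE_I2 order_trans[OF _ abs_ge_self]\<close>)

text \<open>Integrability for the counting measure is absolute summability, so no default value of
  \<open>infsum\<close> intervenes and the rules for integrals become available for the
  operator.\<close>

lemma infsum_eq_integral_count_space:
  fixes p :: "'a \<Rightarrow> real"
  assumes "integrable (count_space UNIV) p"
  shows "(\<Sum>\<^sub>\<infinity>k. p k) = (LINT k|count_space UNIV. p k)"
  using infsetsum_infsum[of p UNIV] assms by (simp add: abs_summable_on_def infsetsum_def)

lemma kernel_sum_le_moment:
  assumes "0 < x"
  shows "(\<integral>\<^sup>+k. ennreal (L (exp (- t k) * x)) \<partial>count_space UNIV) \<le> moment t 0 L"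
  using assms unfolding moment_def nn_integral_count_space_eq_infsum
  by (intro SUP_upper2[of x]) simp_all

text \<open>Every \<open>y > 0\<close> is the argument of the term with index 0 at the point
  \<open>exp (t 0) * y\<close>, so \<open>L y\<close> is one term of a vanishing sum of nonnegative
  extended reals.\<close>

lemma moment_0_eq_0:
  assumes "moment t 0 L = 0" "0 < y" "0 \<le> L y"
  shows "L y = 0"
proof -
  have "(\<integral>\<^sup>+k. ennreal (L (exp (- t k) * (exp (t 0) * y))) \<partial>count_space UNIV) = 0"
    using kernel_sum_le_moment[of "exp (t 0) * y" L t] assms by simp
  then have "\<forall>k. ennreal (L (exp (- t k) * (exp (t 0) * y))) = 0"
    by (subst (asm) nn_integral_0_iff_AE) (simp_all add: AE_count_space)
  then have "ennreal (L (exp (- t 0) * (exp (t 0) * y))) = 0"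
    by blast
  also have "exp (- t 0) * (exp (t 0) * y) = y"
    by (simp add: exp_minus field_simps)
  finally show ?thesis
    using assms(3) by (simp add: ennreal_eq_0_iff)
qed

section \<open>The integral means inside the operator\<close>

text \<open>The prefactor is the reciprocal of the interval length, so this is a true average and
  \<open>jensen_mean\<close> applies to it.\<close>

definition kantorovich_mean :: "(int \<Rightarrow> real) \<Rightarrow> real \<Rightarrow> (real \<Rightarrow> real) \<Rightarrow> int \<Rightarrow> real" where
  "kantorovich_mean t w f k =
     w / (t (k + 1) - t k) * (LINT u:{t k / w..t (k + 1) / w}|lebesgue. f (exp u))"

lemma kantorovich_eq:
  "kantorovich t X w f x = (\<Sum>\<^sub>\<infinity>k. X (exp (- t k) * x powr w) (kantorovich_mean t w f k))"
  by (simp add: kantorovich_def kantorovich_mean_def)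

text \<open>Dividing the affine bound on the integrals by the length \<open>d / w\<close> gives
  \<open>A + B * w / d\<close>, and the gaps satisfy \<open>d \<ge> \<delta>\<close>. Bounded means
  make the series of the operator converge absolutely.\<close>

lemma kantorovich_mean_bounded:
  assumes t: "sampling_sequence t \<delta> \<Delta>" and w: "0 < w"
    and \<eta>: "phi_function \<eta>" "convex_on {0..} \<eta>" and f: "f \<in> mellin_orlicz \<eta>"
  shows "\<exists>D. \<forall>k. \<bar>kantorovich_mean t w f k\<bar> \<le> D"
proof -
  obtain A B where AB: "0 \<le> B"
    "\<And>a b. a \<le> b \<Longrightarrow> \<bar>LINT u:{a..b}|lebesgue. f (exp u)\<bar> \<le> A * (b - a) + B"
    using mellin_orlicz_means(2)[OF \<eta> f] by blast
  have "\<bar>kantorovich_mean t w f k\<bar> \<le> A + B * w / \<delta>" for k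
  proof -
    define d where "d = t (k + 1) - t k"
    have d: "0 < \<delta>" "\<delta> \<le> d" "0 < d"
      using t by (auto simp: sampling_sequence_def d_def)
    have "\<bar>kantorovich_mean t w f k\<bar> = w / d * \<bar>LINT u:{t k / w..t (k + 1) / w}|lebesgue. f (exp u)\<bar>"
      using d w by (simp add: kantorovich_mean_def d_def abs_mult)
    also have "\<dots> \<le> w / d * (A * (t (k + 1) / w - t k / w) + B)"
      using d w by (intro mult_left_mono AB) (auto simp: d_def divide_right_mono)
    also have "t (k + 1) / w - t k / w = d / w"
      by (simp add: d_def diff_divide_distrib)
    also have "w / d * (A * (d / w) + B) = A + B * w / d"
      using d w by (simp add: field_simps)
    also have "\<dots> \<le> A + B * w / \<delta>"
      using d w AB(1) by (intro add_left_mono divide_left_mono) auto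
    finally show ?thesis .
  qed
  then show ?thesis
    by blast
qed

text \<open>By linearity the scaled difference is the mean of \<open>h\<close>. The lower bound on
  the gaps then replaces the reciprocal length by \<open>w / \<delta>\<close>, the source of
  \<open>\<delta>\<close> in the final constant.\<close>

lemma kantorovich_mean_jensen:
  assumes t: "sampling_sequence t \<delta> \<Delta>" and w: "0 < w"
    and \<eta>: "phi_function \<eta>" "convex_on {0..} \<eta>"
    and f: "f \<in> mellin_orlicz \<eta>" and g: "g \<in> mellin_orlicz \<eta>"
  shows "ennreal (\<eta> \<bar>\<nu> * (kantorovich_mean t w f k - kantorovich_mean t w g k)\<bar>)
    \<le> ennreal (w / \<delta>) *
        (\<integral>\<^sup>+u\<in>{t k / w..t (k + 1) / w}. ennreal (\<eta> \<bar>\<nu> * (f (exp u) - g (exp u))\<bar>) \<partial>lebesgue)"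
proof -
  let ?a = "t k / w" and ?b = "t (k + 1) / w"
  define h where "h u = \<nu> * (f (exp u) - g (exp u))" for u
  have d: "0 < \<delta>" "\<delta> \<le> t (k + 1) - t k" "t k < t (k + 1)"
    using t by (auto simp: sampling_sequence_def)
  have ab: "?a < ?b" "1 / (?b - ?a) = w / (t (k + 1) - t k)"
    using d w by (auto simp: divide_strict_right_mono simp flip: diff_divide_distrib)
  note int = mellin_orlicz_means(1)[OF \<eta> f, of ?a ?b] mellin_orlicz_means(1)[OF \<eta> g, of ?a ?b]
  have "1 / (?b - ?a) * (LINT u:{?a..?b}|lebesgue. h u)
      = \<nu> * (kantorovich_mean t w f k - kantorovich_mean t w g k)"
    unfolding ab(2) h_def kantorovich_mean_def
    using int by (simp add: algebra_simps set_integral_diff)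
  then have "ennreal (\<eta> \<bar>\<nu> * (kantorovich_mean t w f k - kantorovich_mean t w g k)\<bar>)
      \<le> ennreal (1 / (?b - ?a)) * (\<integral>\<^sup>+u\<in>{?a..?b}. ennreal (\<eta> \<bar>h u\<bar>) \<partial>lebesgue)"
  proof (subst (asm) eq_commute, elim ssubst, intro jensen_mean)
    show "convex_on UNIV (\<lambda>u. \<eta> \<bar>u\<bar>)"
      using \<eta> by (intro convex_on_abs) (auto simp: phi_function_def)
    show "\<eta> \<bar>0\<bar> = 0"
      using \<eta>(1) by (simp add: phi_function_def)
    show "0 \<le> \<eta> \<bar>y\<bar>" for y
      by (intro phi_function_nonneg[OF \<eta>(1)]) simp
    show "h \<in> borel_measurable lebesgue"
      unfolding h_def using f g
      by (intro borel_measurable_times borel_measurable_const borel_measurable_diff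
          mellin_orlicz_exp_measurable[of _ \<eta>]) auto
    show "set_integrable lebesgue {?a..?b} h"
      unfolding h_def using int by (intro set_integrable_mult_right set_integral_diff) auto
  qed (rule ab)
  also have "\<dots> \<le> ennreal (w / \<delta>) * (\<integral>\<^sup>+u\<in>{?a..?b}. ennreal (\<eta> \<bar>h u\<bar>) \<partial>lebesgue)"
    unfolding ab(2) using d w by (intro mult_right_mono ennreal_leI divide_left_mono) auto
  finally show ?thesis
    unfolding h_def .
qed

section \<open>From the pointwise estimate to the modular estimate\<close>

text \<open>The factor \<open>C / m\<close> is split: \<open>1 / m\<close> normalizes the weights to
  total mass at most 1, as Jensen's inequality requires, while \<open>C\<close> joins
  \<open>\<psi>\<close>, where the hypothesis relating \<open>\<phi>\<close> and
  \<open>\<eta>\<close> acts term by term.\<close>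

lemma kantorovich_diff_bound:
  assumes t: "sampling_sequence t \<delta> \<Delta>" and X: "nonlinear_kernel t L \<psi> \<alpha> \<beta> X"
    and \<phi>: "phi_function \<phi>" "convex_on {0..} \<phi>"
    and \<eta>: "phi_function \<eta>" "convex_on {0..} \<eta>"
    and C: "0 < C" "\<And>u. 0 \<le> u \<Longrightarrow> \<phi> (C * \<psi> u) \<le> \<eta> (\<nu> * u)" and \<nu>: "0 < \<nu>"
    and f: "f \<in> mellin_orlicz \<eta>" and g: "g \<in> mellin_orlicz \<eta>"
    and m: "moment t 0 L = ennreal m" "0 < m" and w: "0 < w" and x: "0 < x"
  shows "ennreal (\<phi> \<bar>C / m * (kantorovich t X w f x - kantorovich t X w g x)\<bar>)
    \<le> (\<integral>\<^sup>+k. ennreal (L (exp (- t k) * x powr w) / m) *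
          ennreal (\<eta> \<bar>\<nu> * (kantorovich_mean t w f k - kantorovich_mean t w g k)\<bar>) \<partial>count_space UNIV)"
proof -
  define y where "y k = exp (- t k) * x powr w" for k
  define a where "a k = L (y k)" for k
  let ?U = "kantorovich_mean t w f" and ?V = "kantorovich_mean t w g"
  have y: "0 < y k" for k
    using x by (simp add: y_def)
  have a: "0 \<le> a k" for k
    using X y by (auto simp: a_def nonlinear_kernel_def)
  have sum_a: "(\<integral>\<^sup>+k. ennreal (a k) \<partial>count_space UNIV) \<le> ennreal m"
    using kernel_sum_le_moment[of "x powr w" L t] x m(1) by (simp add: a_def y_def)
  have fin_a: "(\<integral>\<^sup>+k. ennreal (a k) \<partial>count_space UNIV) < \<infinity>"
    using sum_a by (rule order_le_less_trans) simp
  have \<psi>: "0 \<le> \<psi> u" "\<psi> u \<le> \<psi> v" if "0 \<le> u" "u \<le> v" for u v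
    using X that by (auto simp: nonlinear_kernel_def intro: mono_onD)
  have lip: "\<bar>X (y k) u - X (y k) v\<bar> \<le> a k * \<psi> \<bar>u - v\<bar>" for k u v
    using X y by (simp add: a_def nonlinear_kernel_def)
  obtain D E where D: "\<And>k. \<bar>?U k\<bar> \<le> D" and E: "\<And>k. \<bar>?V k\<bar> \<le> E"
    using kantorovich_mean_bounded[OF t w \<eta> f] kantorovich_mean_bounded[OF t w \<eta> g] by blast
  \<comment> \<open>Comparison with the argument 0, where the kernel vanishes, turns the Lipschitz
    condition into a bound by the summable \<open>a k\<close> times a constant.\<close>
  have int: "integrable (count_space UNIV) (\<lambda>k. X (y k) (U k))" if "\<And>k. \<bar>U k\<bar> \<le> D" for U D
  proof (rule integrable_count_space_bounded[OF a fin_a])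
    fix k
    have "\<bar>X (y k) (U k) - X (y k) 0\<bar> \<le> a k * \<psi> \<bar>U k - 0\<bar>"
      by (rule lip)
    also have "\<dots> \<le> a k * \<psi> D"
      using that by (intro mult_left_mono \<psi> a) auto
    finally show "\<bar>X (y k) (U k)\<bar> \<le> a k * \<psi> D"
      using X y[of k] by (simp add: nonlinear_kernel_def)
  qed
  have int\<psi>: "integrable (count_space UNIV) (\<lambda>k. a k * \<psi> \<bar>?U k - ?V k\<bar>)"
  proof (rule integrable_count_space_bounded[OF a fin_a])
    fix k
    have "\<bar>?U k - ?V k\<bar> \<le> D + E"
      using D[of k] E[of k] by linarith
    then show "\<bar>a k * \<psi> \<bar>?U k - ?V k\<bar>\<bar> \<le> a k * \<psi> (D + E)"
      using a[of k] by (simp add: abs_mult \<psi> mult_left_mono)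
  qed
  have "\<bar>kantorovich t X w f x - kantorovich t X w g x\<bar>
      = \<bar>LINT k|count_space UNIV. X (y k) (?U k) - X (y k) (?V k)\<bar>"
    using int[of ?U, OF D] int[of ?V, OF E]
    by (simp add: kantorovich_eq infsum_eq_integral_count_space flip: y_def)
  also have "\<dots> \<le> (LINT k|count_space UNIV. \<bar>X (y k) (?U k) - X (y k) (?V k)\<bar>)"
    by (rule integral_abs_bound)
  also have "\<dots> \<le> (LINT k|count_space UNIV. a k * \<psi> \<bar>?U k - ?V k\<bar>)"
    using int[of ?U, OF D] int[of ?V, OF E] int\<psi> lip by (intro integral_mono) auto
  finally have "\<bar>C / m * (kantorovich t X w f x - kantorovich t X w g x)\<bar>
      \<le> C / m * (LINT k|count_space UNIV. a k * \<psi> \<bar>?U k - ?V k\<bar>)"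
    using C(1) m(2) by (simp add: abs_mult divide_right_mono)
  also have "\<dots> = (LINT k|count_space UNIV. C / m * (a k * \<psi> \<bar>?U k - ?V k\<bar>))"
    by simp
  also have "\<dots> = (LINT k|count_space UNIV. a k / m * (C * \<psi> \<bar>?U k - ?V k\<bar>))"
    by (intro Bochner_Integration.integral_cong) auto
  \<comment> \<open>The outer absolute value matches the even extension of \<open>\<phi>\<close> to
    which \<open>jensen_series\<close> is applied.\<close>
  finally have le: "\<bar>C / m * (kantorovich t X w f x - kantorovich t X w g x)\<bar>
      \<le> \<bar>LINT k|count_space UNIV. a k / m * (C * \<psi> \<bar>?U k - ?V k\<bar>)\<bar>"
    by linarith
  have "ennreal (\<phi> \<bar>C / m * (kantorovich t X w f x - kantorovich t X w g x)\<bar>)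
      \<le> ennreal (\<phi> \<bar>LINT k|count_space UNIV. a k / m * (C * \<psi> \<bar>?U k - ?V k\<bar>)\<bar>)"
    using \<phi>(1) le by (intro ennreal_leI mono_onD[of "{0..}" \<phi>]) (auto simp: phi_function_def)
  also have "\<dots> \<le> (\<integral>\<^sup>+k. ennreal (a k / m) * ennreal (\<phi> \<bar>C * \<psi> \<bar>?U k - ?V k\<bar>\<bar>) \<partial>count_space UNIV)"
  proof (rule jensen_series)
    show "convex_on UNIV (\<lambda>u. \<phi> \<bar>u\<bar>)"
      using \<phi> by (intro convex_on_abs) (auto simp: phi_function_def)
    show "\<phi> \<bar>0\<bar> = 0"
      using \<phi>(1) by (simp add: phi_function_def)
    show "0 \<le> \<phi> \<bar>y\<bar>" for y
      by (intro phi_function_nonneg[OF \<phi>(1)]) simp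
    show "0 \<le> a k / m" for k
      using a m(2) by simp
    have "(\<integral>\<^sup>+k. ennreal (a k / m) \<partial>count_space UNIV)
        = (\<integral>\<^sup>+k. ennreal (1 / m) * ennreal (a k) \<partial>count_space UNIV)"
      using a m(2) by (simp flip: ennreal_mult)
    also have "\<dots> \<le> ennreal (1 / m) * ennreal m"
      using sum_a by (simp add: nn_integral_cmult mult_left_mono)
    also have "\<dots> = 1"
      using m(2) by (simp flip: ennreal_mult)
    finally show "(\<integral>\<^sup>+k. ennreal (a k / m) \<partial>count_space UNIV) \<le> 1" .
    have "integrable (count_space UNIV) (\<lambda>k. C / m * (a k * \<psi> \<bar>?U k - ?V k\<bar>))"
      using int\<psi> by (rule integrable_mult_right)
    then show "integrable (count_space UNIV) (\<lambda>k. a k / m * (C * \<psi> \<bar>?U k - ?V k\<bar>))"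
      by (simp add: mult_ac)
  qed
  also have "\<dots> \<le> (\<integral>\<^sup>+k. ennreal (a k / m) * ennreal (\<eta> \<bar>\<nu> * (?U k - ?V k)\<bar>) \<partial>count_space UNIV)"
  proof (intro nn_integral_mono mult_left_mono ennreal_leI)
    fix k
    have "\<bar>C * \<psi> \<bar>?U k - ?V k\<bar>\<bar> = C * \<psi> \<bar>?U k - ?V k\<bar>"
      using C(1) \<psi>(1)[OF abs_ge_zero order_refl] by simp
    then show "\<phi> \<bar>C * \<psi> \<bar>?U k - ?V k\<bar>\<bar> \<le> \<eta> \<bar>\<nu> * (?U k - ?V k)\<bar>"
      using C(2)[of "\<bar>?U k - ?V k\<bar>"] \<nu> by (simp add: abs_mult)
  qed simp
  finally show ?thesis
    by (simp add: a_def y_def)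
qed

text \<open>The closed intervals share endpoints, so they are first cut to disjoint half-open cells.
  After exchanging sum and integral, at most one term survives at each point.\<close>

lemma nn_integral_sampling_intervals:
  fixes F :: "real \<Rightarrow> ennreal"
  assumes t: "sampling_sequence t \<delta> \<Delta>" and w: "0 < w" and F: "F \<in> borel_measurable lebesgue"
  shows "(\<integral>\<^sup>+k. (\<integral>\<^sup>+u\<in>{t k / w..t (k + 1) / w}. F u \<partial>lebesgue) \<partial>count_space UNIV)
    \<le> (\<integral>\<^sup>+u. F u \<partial>lebesgue)"
proof -
  let ?J = "\<lambda>k. {t k / w..<t (k + 1) / w}"
  have "(\<integral>\<^sup>+k. (\<integral>\<^sup>+u\<in>{t k / w..t (k + 1) / w}. F u \<partial>lebesgue) \<partial>count_space UNIV)
      = (\<integral>\<^sup>+k. (\<integral>\<^sup>+u. F u * indicator (?J k) u \<partial>lebesgue) \<partial>count_space UNIV)"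
  proof (rule nn_integral_cong, rule nn_integral_cong_AE)
    fix k
    \<comment> \<open>Only the right endpoint is dropped, which is a null set.\<close>
    have "AE u in lebesgue. u \<noteq> t (k + 1) / w"
      by (intro AE_completion AE_lborel_singleton)
    then show "AE u in lebesgue. F u * indicator {t k / w..t (k + 1) / w} u = F u * indicator (?J k) u"
      by eventually_elim (auto split: split_indicator)
  qed
  also have "\<dots> = (\<integral>\<^sup>+u. (\<integral>\<^sup>+k. F u * indicator (?J k) u \<partial>count_space UNIV) \<partial>lebesgue)"
    by (rule nn_integral_count_space_nn_integral[symmetric])
       (auto intro!: borel_measurable_times_ennreal borel_measurable_indicator F)
  also have "\<dots> \<le> (\<integral>\<^sup>+u. F u \<partial>lebesgue)"
  proof (intro nn_integral_mono)
    fix u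
    \<comment> \<open>Multiplying by \<open>w\<close> returns the scaled cells to those of
      \<open>t\<close>.\<close>
    have unique: "i = j" if "u \<in> ?J i" "u \<in> ?J j" for i j
      using that w by (intro sampling_sequence_unique[OF t, of i "u * w"]) (auto simp: field_simps)
    have "(\<integral>\<^sup>+k. F u * indicator (?J k) u \<partial>count_space UNIV)
        = F u * (\<integral>\<^sup>+k. of_bool (u \<in> ?J k) \<partial>count_space UNIV)"
      by (subst nn_integral_cmult[symmetric]) (simp_all add: indicator_def)
    also have "\<dots> = F u * of_bool (\<exists>k\<in>UNIV. u \<in> ?J k)"
      using unique by (subst of_bool_Bex_eq_nn_integral) auto
    also have "\<dots> \<le> F u"
      by simp
    finally show "(\<integral>\<^sup>+k. F u * indicator (?J k) u \<partial>count_space UNIV) \<le> F u" .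
  qed
  finally show ?thesis .
qed

text \<open>The coefficients \<open>d k\<close> do not depend on \<open>x\<close>, so after Tonelli
  only the kernel is integrated in \<open>x\<close>, giving the same constant
  \<open>l / (m * w)\<close> for every \<open>k\<close>. The means contribute
  \<open>w / \<delta>\<close> and the cells add up to at most the full modular.\<close>

lemma kantorovich_modular_bound:
  assumes t: "sampling_sequence t \<delta> \<Delta>" and X: "nonlinear_kernel t L \<psi> \<alpha> \<beta> X"
    and \<phi>: "phi_function \<phi>" "convex_on {0..} \<phi>"
    and \<eta>: "phi_function \<eta>" "convex_on {0..} \<eta>"
    and C: "0 < C" "\<And>u. 0 \<le> u \<Longrightarrow> \<phi> (C * \<psi> u) \<le> \<eta> (\<nu> * u)" and \<nu>: "0 < \<nu>"
    and f: "f \<in> mellin_orlicz \<eta>" and g: "g \<in> mellin_orlicz \<eta>"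
    and m: "moment t 0 L = ennreal m" "0 < m" and w: "0 < w"
  shows "modular \<phi> (\<lambda>x. C / m * (kantorovich t X w f x - kantorovich t X w g x))
    \<le> ennreal (LINT x|haar. \<bar>L x\<bar>) / (ennreal \<delta> * ennreal m) * modular \<eta> (\<lambda>x. \<nu> * (f x - g x))"
proof -
  define d where "d k = ennreal (\<eta> \<bar>\<nu> * (kantorovich_mean t w f k - kantorovich_mean t w g k)\<bar>)" for k
  define F where "F x = ennreal (\<eta> \<bar>\<nu> * (f x - g x)\<bar>)" for x
  define l where "l = (LINT x|haar. \<bar>L x\<bar>)"
  have \<delta>: "0 < \<delta>"
    using t by (simp add: sampling_sequence_def)
  have L [measurable]: "L \<in> borel_measurable haar" and "integrable haar L"
    and L_nonneg: "\<And>x. 0 < x \<Longrightarrow> 0 \<le> L x"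
    using X by (auto simp: nonlinear_kernel_def)
  have l: "(\<integral>\<^sup>+x. ennreal (L x) \<partial>haar) = ennreal l"
    unfolding l_def using \<open>integrable haar L\<close> L_nonneg
    by (subst nn_integral_eq_integral[symmetric]) (auto intro!: nn_integral_cong)
  have l_nonneg: "0 \<le> l"
    unfolding l_def by simp
  have F: "F \<in> borel_measurable haar"
  proof -
    have [measurable]: "f \<in> borel_measurable haar" "g \<in> borel_measurable haar"
      using f g by (auto simp: mellin_orlicz_def)
    note [measurable] = phi_function_measurable[OF \<eta>(1)]
    show ?thesis
      unfolding F_def[abs_def] by measurable
  qed
  have L_arg: "(\<lambda>x. ennreal (L (exp (- t k) * x powr w) / m)) \<in> borel_measurable haar" for k
    using measurable_compose[OF measurable_kernel_argument[OF w] L] by measurable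
  have "modular \<phi> (\<lambda>x. C / m * (kantorovich t X w f x - kantorovich t X w g x))
      \<le> (\<integral>\<^sup>+x. (\<integral>\<^sup>+k. ennreal (L (exp (- t k) * x powr w) / m) * d k \<partial>count_space UNIV) \<partial>haar)"
    unfolding modular_def d_def
    by (intro nn_integral_mono kantorovich_diff_bound[OF t X \<phi> \<eta> C \<nu> f g m w]) auto
  also have "\<dots> = (\<integral>\<^sup>+k. (\<integral>\<^sup>+x. ennreal (L (exp (- t k) * x powr w) / m) * d k \<partial>haar) \<partial>count_space UNIV)"
    by (intro nn_integral_count_space_nn_integral borel_measurable_times_ennreal L_arg) auto
  also have "\<dots> = (\<integral>\<^sup>+k. ennreal (l / (m * w)) * d k \<partial>count_space UNIV)"
  proof (intro nn_integral_cong)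
    fix k
    have "(\<integral>\<^sup>+x. ennreal (L (exp (- t k) * x powr w) / m) \<partial>haar)
        = ennreal (1 / w) * (\<integral>\<^sup>+x. ennreal (L x / m) \<partial>haar)"
      by (rule nn_integral_kernel_argument[OF _ w]) auto
    also have "(\<integral>\<^sup>+x. ennreal (L x / m) \<partial>haar) = (\<integral>\<^sup>+x. ennreal (1 / m) * ennreal (L x) \<partial>haar)"
      using L_nonneg m(2) by (intro nn_integral_cong) (simp flip: ennreal_mult)
    also have "\<dots> = ennreal (1 / m) * ennreal l"
      by (simp add: nn_integral_cmult l)
    also have "ennreal (1 / w) * (ennreal (1 / m) * ennreal l) = ennreal (l / (m * w))"
      using m(2) w l_nonneg by (simp add: mult.commute flip: ennreal_mult)
    finally show "(\<integral>\<^sup>+x. ennreal (L (exp (- t k) * x powr w) / m) * d k \<partial>haar) = ennreal (l / (m * w)) * d k"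
      by (simp add: nn_integral_multc L_arg)
  qed
  also have "\<dots> \<le> (\<integral>\<^sup>+k. ennreal (l / (m * w)) * (ennreal (w / \<delta>) *
        (\<integral>\<^sup>+u\<in>{t k / w..t (k + 1) / w}. F (exp u) \<partial>lebesgue)) \<partial>count_space UNIV)"
    unfolding d_def F_def
    by (intro nn_integral_mono mult_left_mono kantorovich_mean_jensen[OF t w \<eta> f g]) auto
  also have "\<dots> = ennreal (l / (m * w)) * (ennreal (w / \<delta>) *
      (\<integral>\<^sup>+k. (\<integral>\<^sup>+u\<in>{t k / w..t (k + 1) / w}. F (exp u) \<partial>lebesgue) \<partial>count_space UNIV))"
    by (simp add: nn_integral_cmult)
  also have "\<dots> \<le> ennreal (l / (m * w)) * (ennreal (w / \<delta>) * (\<integral>\<^sup>+u. F (exp u) \<partial>lebesgue))"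
    by (intro mult_left_mono nn_integral_sampling_intervals[OF t w] measurable_compose[OF measurable_exp_haar F]) auto
  also have "\<dots> = ennreal (l / (m * w) * (w / \<delta>)) * modular \<eta> (\<lambda>x. \<nu> * (f x - g x))"
  proof -
    have "(\<integral>\<^sup>+u. F (exp u) \<partial>lebesgue) = modular \<eta> (\<lambda>x. \<nu> * (f x - g x))"
      unfolding nn_integral_haar[OF F, symmetric] by (simp add: modular_def F_def[abs_def])
    moreover have "ennreal (l / (m * w) * (w / \<delta>)) = ennreal (l / (m * w)) * ennreal (w / \<delta>)"
      using l_nonneg m(2) w \<delta> by (intro ennreal_mult) auto
    ultimately show ?thesis
      by (simp only: mult.assoc)
  qed
  \<comment> \<open>The factors \<open>w\<close> cancel, so the constant is uniform in
    \<open>w\<close>.\<close>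
  also have "ennreal (l / (m * w) * (w / \<delta>)) = ennreal l / (ennreal \<delta> * ennreal m)"
    using l_nonneg m(2) w \<delta> by (simp add: divide_ennreal mult.commute flip: ennreal_mult)
  finally show ?thesis
    by (simp add: l_def)
qed

section \<open>Combining the cases of vanishing and positive moment of order zero\<close>

theorem theorem12:
  fixes t :: "int \<Rightarrow> real" and \<delta> \<Delta> \<alpha> \<beta> :: real
    and X :: "real \<Rightarrow> real \<Rightarrow> real"
    and L \<psi> \<phi> \<eta> C f g :: "real \<Rightarrow> real"
  assumes "sampling_sequence t \<delta> \<Delta>"
    and "nonlinear_kernel t L \<psi> \<alpha> \<beta> X"
    and "phi_function \<phi>" and "convex_on {0..} \<phi>"
    and "phi_function \<eta>" and "convex_on {0..} \<eta>"
    and "\<And>\<nu>. \<nu> \<in> {0<..<1} \<Longrightarrow> C \<nu> \<in> {0<..<1}"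
    and "\<And>\<nu> u. \<nu> \<in> {0<..<1} \<Longrightarrow> 0 \<le> u \<Longrightarrow> \<phi> (C \<nu> * \<psi> u) \<le> \<eta> (\<nu> * u)"
    and "f \<in> mellin_orlicz \<eta>" and "g \<in> mellin_orlicz \<eta>"
  shows "\<exists>\<nu>\<in>{0<..<1}. \<exists>c>0. ennreal c \<le> ennreal (C \<nu>) / moment t 0 L \<and>
    (\<forall>w>0. modular \<phi> (\<lambda>x. c * (kantorovich t X w f x - kantorovich t X w g x))
       \<le> ennreal (LINT x|haar. \<bar>L x\<bar>) / (ennreal \<delta> * moment t 0 L)
           * modular \<eta> (\<lambda>x. \<nu> * (f x - g x)))"
proof -
  define \<nu> :: real where "\<nu> = 1 / 2"
  have \<nu>: "\<nu> \<in> {0<..<1}"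
    by (simp add: \<nu>_def)
  have C: "0 < C \<nu>"
    using assms(7)[OF \<nu>] by simp
  have L: "\<And>x. 0 < x \<Longrightarrow> 0 \<le> L x" "bounded (L ` {0<..})" "0 < \<beta>" "moment t \<beta> L < \<infinity>"
    using assms(2) by (auto simp: nonlinear_kernel_def)
  obtain m where m: "0 \<le> m" "moment t 0 L = ennreal m"
    using moment_0_finite[OF assms(1) L] by (cases "moment t 0 L") auto
  show ?thesis
  proof (cases "m = 0")
    \<comment> \<open>Here \<open>L\<close> vanishes on the positive reals, and the Lipschitz
      condition against the argument 0 forces the kernel, hence both operators, to vanish
      there.\<close>
    case True
    then have "L y = 0" if "0 < y" for y
      using moment_0_eq_0[of t L y] that m(2) L(1) by simp
    moreover have "\<bar>X y u - X y 0\<bar> \<le> L y * \<psi> \<bar>u - 0\<bar>" "X y 0 = 0" if "0 < y" for y u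
      using assms(2) that unfolding nonlinear_kernel_def by blast+
    ultimately have "X y u = 0" if "0 < y" for y u
      using that by (metis abs_le_zero_iff diff_zero mult_zero_left)
    then have "kantorovich t X w h x = 0" if "0 < x" for w h x
      using that by (simp add: kantorovich_def)
    moreover have "\<phi> 0 = 0"
      using assms(3) by (simp add: phi_function_def)
    ultimately have "modular \<phi> (\<lambda>x. 1 * (kantorovich t X w f x - kantorovich t X w g x)) = 0" for w
      unfolding modular_def by (simp cong: nn_integral_cong_simp)
    \<comment> \<open>Division of a positive \<open>ennreal\<close> by 0 is infinite, so every
      positive \<open>c\<close> is admissible and 1 serves as the witness.\<close>
    moreover have "ennreal (C \<nu>) / moment t 0 L = \<infinity>"
      using True m C by (simp add: ennreal_divide_zero)
    ultimately show ?thesis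
      using \<nu> by (intro bexI[of _ \<nu>] exI[of _ "1::real"]) auto
  next
    case False
    then have "0 < m"
      using m(1) by simp
    moreover have "ennreal (C \<nu> / m) \<le> ennreal (C \<nu>) / moment t 0 L"
      using \<open>0 < m\<close> m(2) C by (simp add: divide_ennreal)
    moreover have "modular \<phi> (\<lambda>x. C \<nu> / m * (kantorovich t X w f x - kantorovich t X w g x))
       \<le> ennreal (LINT x|haar. \<bar>L x\<bar>) / (ennreal \<delta> * moment t 0 L) * modular \<eta> (\<lambda>x. \<nu> * (f x - g x))"
      if "0 < w" for w
      unfolding m(2)
      using \<nu> that
      by (intro kantorovich_modular_bound[OF assms(1-6) C assms(8)[OF \<nu>] _ assms(9,10) m(2) \<open>0 < m\<close>]) auto
    ultimately show ?thesis
      using \<nu> C by (intro bexI[of _ \<nu>] exI[of _ "C \<nu> / m"]) auto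
  qed
qed

end
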